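(* The map associating to each matroid $\mathsf{M}$ the flag $f$-vector $\alpha_{\mathsf{M}}$ of its lattice of flats $\mathcal{L}(\mathsf{M})$ is a valuative invariant.
   Context: All matroids have finite ground sets contained in the positive integers. $\mathcal{L}(\mathsf{M})$ is the lattice of flats of $\mathsf{M}$. The flag $f$-vector of $\mathcal{L}(\mathsf{M})$ is the function $\alpha_{\mathsf{M}}$ from finite sets of non-negative integers to $\mathbb{Z}$ given, for $r_1<\dots<r_s$, by \[\alpha_{\mathsf{M}}(\{r_1,\dots,r_s\})=\#\{\text{flags } F_1\subseteq\cdots\subseteq F_s \text{ in } \mathcal{L}(\mathsf{M}) : \operatorname{rk}(F_i)=r_i \text{ for each } i\}.\] It is regarded as an element of the abelian group of $\mathbb{Z}$-valued functions on finite sets of non-negative integers. The base polytope of a matroid $\mathsf{M}$ on $E$ with bases $\mathscr{B}$ is $\mathscr{P}(\mathsf{M})=\operatorname{conv}\{\sum_{i\in B}e_i : B\in\mathscr{B}\}\subseteq\mathbb{R}^E$, with indicator function $\mathbf{1}_{\mathscr{P}(\mathsf{M})}:\mathbb{R}^E\to\mathbb{Z}$. A map $f$ from matroids to an abelian group is a valuation if $\sum_{i}a_if(\mathsf{M}_i)=0$ whenever $\mathsf{M}_1,\dots,\mathsf{M}_s$ are matroids on a common ground set and $a_i\in\mathbb{Z}$ satisfy $\sum_i a_i\mathbf{1}_{\mathscr{P}(\mathsf{M}_i)}=0$. (This is known to be equivalent to the inclusion–exclusion property under matroid subdivisions.) A valuative invariant is a valuation with $f(\mathsf{M})=f(\mathsf{N})$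 whenever $\mathsf{M}\cong\mathsf{N}$. *)

theory Defs
  imports "HOL-Analysis.Analysis" "HOL-Analysis.Finite_Function_Topology"
    "HOL-Library.Function_Algebras" "HOL-Library.FSet"
begin

typedef matroid = "{(E :: nat set, \<B> :: nat set set).
    finite E \<and> 0 \<notin> E \<and> \<B> \<noteq> {} \<and> (\<forall>B\<in>\<B>. B \<subseteq> E) \<and>
    (\<forall>A\<in>\<B>. \<forall>B\<in>\<B>. \<forall>x\<in>A - B. \<exists>y\<in>B - A. insert y (A - {x}) \<in> \<B>)}"
  by (rule exI[of _ "({}, {{}})"]) simp

definition ground :: "matroid \<Rightarrow> nat set" where
  "ground M = fst (Rep_matroid M)"

definition bases :: "matroid \<Rightarrow> nat set set" where
  "bases M = snd (Rep_matroid M)"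

definition matroid_iso :: "matroid \<Rightarrow> matroid \<Rightarrow> bool" where
  "matroid_iso M N \<longleftrightarrow>
     (\<exists>\<phi>. bij_betw \<phi> (ground M) (ground N) \<and>
          (\<forall>B\<subseteq>ground M. B \<in> bases M \<longleftrightarrow> \<phi> ` B \<in> bases N))"

definition indep :: "matroid \<Rightarrow> nat set \<Rightarrow> bool" where
  "indep M I \<longleftrightarrow> (\<exists>B\<in>bases M. I \<subseteq> B)"

definition rk :: "matroid \<Rightarrow> nat set \<Rightarrow> nat" where
  "rk M S = Max (card ` {I. I \<subseteq> S \<and> indep M I})"

text \<open>The lattice of flats is this set ordered by inclusion.\<close>

definition flats :: "matroid \<Rightarrow> nat set set" where
  "flats M = {F. F \<subseteq> ground M \<and> (\<forall>e\<in>ground M - F. rk M F < rk M (insert e F))}"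

text \<open>For \<open>R = {r\<^sub>1 < \<dots> < r\<^sub>s}\<close>, a flag is the list \<open>[F\<^sub>1, \<dots>, F\<^sub>s]\<close>.  For empty \<open>R\<close> the
  only flag is the empty one.\<close>

definition flags :: "matroid \<Rightarrow> nat fset \<Rightarrow> nat set list set" where
  "flags M R = {Fs. set Fs \<subseteq> flats M \<and> sorted_wrt (\<subseteq>) Fs \<and>
                    map (rk M) Fs = sorted_list_of_fset R}"

definition flag_f_vector :: "matroid \<Rightarrow> nat fset \<Rightarrow> int" where
  "flag_f_vector M R = int (card (flags M R))"

text \<open>\<open>\<real>\<^sup>E\<close> is realised inside the real vector space of finitely supported functions on
  \<^typ>\<open>nat\<close>, as the subspace of functions supported in \<open>E\<close>.\<close>

definition coord_space :: "nat set \<Rightarrow> (nat \<Rightarrow>\<^sub>0 real) set" where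
  "coord_space E = {x. Poly_Mapping.keys x \<subseteq> E}"

definition base_polytope :: "matroid \<Rightarrow> (nat \<Rightarrow>\<^sub>0 real) set" where
  "base_polytope M = convex hull ((\<lambda>B. \<Sum>i\<in>B. Poly_Mapping.single i 1) ` bases M)"

text \<open>The \<open>\<int>\<close>-module structure of an abelian group.\<close>

definition int_scale :: "int \<Rightarrow> 'a \<Rightarrow> 'a :: ab_group_add" where
  "int_scale a x = (\<Sum>k<nat a. x) - (\<Sum>k<nat (- a). x)"

definition valuation :: "(matroid \<Rightarrow> 'a :: ab_group_add) \<Rightarrow> bool" where
  "valuation f \<longleftrightarrow>
     (\<forall>(s :: nat) (E :: nat set) (M :: nat \<Rightarrow> matroid) (a :: nat \<Rightarrow> int).
        (\<forall>i\<in>{1..s}. ground (M i) = E) \<longrightarrow>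
        (\<forall>x\<in>coord_space E. (\<Sum>i=1..s. a i * indicator (base_polytope (M i)) x) = 0) \<longrightarrow>
        (\<Sum>i=1..s. int_scale (a i) (f (M i))) = 0)"

definition valuative_invariant :: "(matroid \<Rightarrow> 'a :: ab_group_add) \<Rightarrow> bool" where
  "valuative_invariant f \<longleftrightarrow>
     valuation f \<and> (\<forall>M N. matroid_iso M N \<longrightarrow> f M = f N)"

end

theory Submission
  imports Defs
begin

text \<open>
  The Euler characteristic is additive on compact convex sets: a linear relation
  \<open>\<Sum>\<^sub>i a\<^sub>i \<^bold>1\<^bsub>K\<^sub>i\<^esub> = 0\<close> forces the sum of the \<open>a\<^sub>i\<close> with \<open>K\<^sub>i \<noteq> {}\<close> to vanish, by slicing with one
  coordinate at a time until only intervals are left.  Slicing with a linear functional \<open>w\<close> shows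
  in the same way that the sum of the \<open>a\<^sub>i\<close> with \<open>max w(K\<^sub>i) = t\<close> vanishes.

  For a chain \<open>\<C>\<close> of subsets of \<open>E\<close>, some basis meets every \<open>C \<in> \<C>\<close> in \<open>rk C\<close> elements, so
  \<open>w = \<Sum>\<^sub>C \<epsilon>\<^sub>C \<^bold>1\<^sub>C\<close> has maximum \<open>\<Sum>\<^sub>C \<epsilon>\<^sub>C rk C\<close> on the base polytope.  For widely separated weights
  this number determines all the ranks; hence prescribing the ranks along a chain is valuative.

  Finally, if \<open>F\<^sub>i \<subseteq> F\<^sub>i\<^sub>+\<^sub>1\<close> and \<open>F\<^sub>i\<^sub>+\<^sub>1\<close> is a flat, then \<open>F\<^sub>i\<close> is a flat iff it is closed in \<open>F\<^sub>i\<^sub>+\<^sub>1\<close>, and the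
  indicator of the latter is the alternating sum of \<open>[rk A = rk F\<^sub>i]\<close> over \<open>F\<^sub>i \<subseteq> A \<subseteq> F\<^sub>i\<^sub>+\<^sub>1\<close>.  All sets
  involved form a chain, so the number of flags of flats is a signed sum of valuative indicators.
\<close>

section \<open>The Euler characteristic of compact convex sets\<close>

lemma compact_convex_real_interval:
  fixes J :: "real set"
  assumes "compact J" "convex J"
  obtains l u where "J = {l..u}"
  using assms connected_compact_interval_1 convex_connected by blast

text \<open>The relation at a point slightly to the right of \<open>t\<close> is subtracted from the
  relation at \<open>t\<close>. Finiteness of \<open>I\<close> lets one such point serve all the
  intervals at once.\<close>

lemma sum_interval_tops_eq_0:
  fixes J :: "'i \<Rightarrow> real set" and a :: "'i \<Rightarrow> int"
  assumes fin: "finite I"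
    and cc: "\<And>i. i \<in> I \<Longrightarrow> compact (J i) \<and> convex (J i)"
    and zero: "\<And>t. (\<Sum>i\<in>I. a i * of_bool (t \<in> J i)) = 0"
  shows "(\<Sum>i\<in>I. a i * of_bool (t \<in> J i \<and> (\<forall>s\<in>J i. s \<le> t))) = 0"
proof -
  have ev: "eventually (\<lambda>s. s \<in> J i \<longleftrightarrow> t \<in> J i \<and> (\<exists>u\<in>J i. t < u)) (at_right t)"
    if "i \<in> I" for i
  proof -
    obtain l u where J: "J i = {l..u}"
      using cc[OF \<open>i \<in> I\<close>] compact_convex_real_interval by metis
    consider "t < l" | "l \<le> t" "t < u" | "u \<le> t" by linarith
    then show ?thesis
    proof cases
      case 1
      then show ?thesis unfolding eventually_at_right_field J
        by (intro exI[of _ l]) auto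
    next
      case 2
      then show ?thesis unfolding eventually_at_right_field J
        by (intro exI[of _ u]) auto
    next
      case 3
      then show ?thesis unfolding eventually_at_right_field J
        by (intro exI[of _ "t + 1"]) auto
    qed
  qed
  \<comment> \<open>Just to the right of \<open>t\<close>, precisely the intervals with maximum \<open>t\<close> have been left.\<close>
  have "eventually (\<lambda>s. \<forall>i\<in>I. s \<in> J i \<longleftrightarrow> t \<in> J i \<and> (\<exists>u\<in>J i. t < u)) (at_right t)"
    by (rule eventually_ball_finite[OF fin]) (use ev in blast)
  then obtain s where s: "\<And>i. i \<in> I \<Longrightarrow> s \<in> J i \<longleftrightarrow> t \<in> J i \<and> (\<exists>u\<in>J i. t < u)"
    using eventually_happens'[OF trivial_limit_at_right_real] by blast
  have "(\<Sum>i\<in>I. a i * of_bool (t \<in> J i \<and> (\<forall>s\<in>J i. s \<le> t)))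
      = (\<Sum>i\<in>I. a i * of_bool (t \<in> J i) - a i * of_bool (s \<in> J i))"
    by (intro sum.cong refl) (auto simp: s of_bool_def not_less)
  then show ?thesis by (simp add: sum_subtractf zero)
qed

text \<open>A nonempty compact interval has exactly one maximum, so summing the preceding identity
  over all candidate maxima counts each nonempty interval once.\<close>

lemma sum_nonempty_intervals_eq_0:
  fixes J :: "'i \<Rightarrow> real set" and a :: "'i \<Rightarrow> int"
  assumes fin: "finite I"
    and cc: "\<And>i. i \<in> I \<Longrightarrow> compact (J i) \<and> convex (J i)"
    and zero: "\<And>t. (\<Sum>i\<in>I. a i * of_bool (t \<in> J i)) = 0"
  shows "(\<Sum>i\<in>I. a i * of_bool (J i \<noteq> {})) = 0"
proof -
  define T where "T = (\<lambda>i. Sup (J i)) ` I"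
  have top: "t \<in> J i \<and> (\<forall>s\<in>J i. s \<le> t) \<longleftrightarrow> J i \<noteq> {} \<and> t = Sup (J i)" if "i \<in> I" for i t
  proof -
    obtain l u where J: "J i = {l..u}"
      using cc[OF \<open>i \<in> I\<close>] compact_convex_real_interval by metis
    show ?thesis by (cases "l \<le> u") (auto simp: J intro: antisym)
  qed
  have "(\<Sum>i\<in>I. a i * of_bool (J i \<noteq> {}))
      = (\<Sum>i\<in>I. \<Sum>t\<in>T. a i * of_bool (t \<in> J i \<and> (\<forall>s\<in>J i. s \<le> t)))"
  proof (intro sum.cong refl)
    fix i assume i: "i \<in> I"
    have "(\<Sum>t\<in>T. a i * of_bool (t \<in> J i \<and> (\<forall>s\<in>J i. s \<le> t)))
        = (\<Sum>t\<in>T. if t = Sup (J i) then a i * of_bool (J i \<noteq> {}) else 0)"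
      by (intro sum.cong refl) (simp add: top[OF i])
    also have "\<dots> = a i * of_bool (J i \<noteq> {})"
      using i fin by (simp add: T_def)
    finally show "a i * of_bool (J i \<noteq> {})
        = (\<Sum>t\<in>T. a i * of_bool (t \<in> J i \<and> (\<forall>s\<in>J i. s \<le> t)))" by simp
  qed
  also have "\<dots> = (\<Sum>t\<in>T. \<Sum>i\<in>I. a i * of_bool (t \<in> J i \<and> (\<forall>s\<in>J i. s \<le> t)))"
    by (rule sum.swap)
  also have "\<dots> = 0"
    using sum_interval_tops_eq_0[OF assms] by simp
  finally show ?thesis .
qed

section \<open>Slicing compact convex sets with linear functionals\<close>

lemma
  fixes K :: "'v::real_normed_vector set"
  assumes "compact K" "convex K" "bounded_linear w"
  shows compact_slice: "compact (K \<inter> {x. w x = t})"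
    and convex_slice: "convex (K \<inter> {x. w x = t})"
    and compact_linear_functional_image: "compact (w ` K)"
    and convex_linear_functional_image: "convex (w ` K)"
proof -
  interpret w: bounded_linear w by fact
  have "closed {x. w x = t}"
    by (intro closed_Collect_eq linear_continuous_on assms(3) continuous_on_const)
  then show "compact (K \<inter> {x. w x = t})"
    using assms by (simp add: compact_Int_closed)
  have "convex (w -` {t})"
    by (intro convex_linear_vimage w.linear convex_singleton)
  then show "convex (K \<inter> {x. w x = t})"
    using assms by (auto intro!: convex_Int simp: vimage_def)
  show "compact (w ` K)"
    by (intro compact_continuous_image linear_continuous_on assms)
  show "convex (w ` K)"
    by (intro convex_linear_image w.linear assms)
qed

text \<open>Induction on the separating functionals rather than on the dimension, since the ambient
  space may be infinite-dimensional. On a slice of constant \<open>w\<close> the remaining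
  functionals still separate points, so the induction hypothesis yields a relation between the
  intervals that are the images of the \<open>K i\<close> under \<open>w\<close>. An image is empty
  only if \<open>K i\<close> is.\<close>

lemma sum_nonempty_compact_convex_eq_0:
  fixes K :: "'i \<Rightarrow> 'v::real_normed_vector set" and a :: "'i \<Rightarrow> int"
  assumes "finite \<Phi>" and "finite I"
    and "\<And>w. w \<in> \<Phi> \<Longrightarrow> bounded_linear (w :: 'v \<Rightarrow> real)"
    and "\<And>i. i \<in> I \<Longrightarrow> compact (K i) \<and> convex (K i)"
    and "\<And>x y. x \<in> (\<Union>i\<in>I. K i) \<Longrightarrow> y \<in> (\<Union>i\<in>I. K i) \<Longrightarrow> \<forall>w\<in>\<Phi>. w x = w y \<Longrightarrow> x = y"
    and "\<And>x. (\<Sum>i\<in>I. a i * of_bool (x \<in> K i)) = 0"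
  shows "(\<Sum>i\<in>I. a i * of_bool (K i \<noteq> {})) = 0"
  using assms(1,3-)
proof (induction \<Phi> arbitrary: K rule: finite_induct)
  case empty
  show ?case
  proof (cases "(\<Union>i\<in>I. K i) = {}")
    case True
    then show ?thesis by (intro sum.neutral) auto
  next
    case False
    \<comment> \<open>With no functionals left the union has at most one point, so every nonempty
      \<open>K i\<close> equals \<open>{x}\<close>.\<close>
    then obtain x where x: "x \<in> (\<Union>i\<in>I. K i)" by blast
    with empty.prems(3) have "i \<in> I \<Longrightarrow> K i \<noteq> {} \<longleftrightarrow> x \<in> K i" for i by blast
    with empty.prems(4)[of x] show ?thesis by (simp cong: sum.cong)
  qed
next
  case (insert w \<Phi>)
  have w: "bounded_linear w" using insert.prems by simp
  have slice: "(\<Sum>i\<in>I. a i * of_bool (t \<in> w ` K i)) = 0" for t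
  proof -
    have "(\<Sum>i\<in>I. a i * of_bool (K i \<inter> {x. w x = t} \<noteq> {})) = 0"
    proof (rule insert.IH)
      show "(\<Sum>i\<in>I. a i * of_bool (x \<in> K i \<inter> {x. w x = t})) = 0" for x
        using insert.prems(4)[of x] by (cases "w x = t") auto
      show "x = y" if "x \<in> (\<Union>i\<in>I. K i \<inter> {x. w x = t})" "y \<in> (\<Union>i\<in>I. K i \<inter> {x. w x = t})"
        "\<forall>w\<in>\<Phi>. w x = w y" for x y
        using that by (intro insert.prems(3)) auto
    qed (use insert.prems w in \<open>auto intro: compact_slice convex_slice\<close>)
    moreover have "K i \<inter> {x. w x = t} \<noteq> {} \<longleftrightarrow> t \<in> w ` K i" for i by auto
    ultimately show ?thesis by simp
  qed
  have "(\<Sum>i\<in>I. a i * of_bool (w ` K i \<noteq> {})) = 0"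
    using sum_nonempty_intervals_eq_0[where J = "\<lambda>i. w ` K i", OF \<open>finite I\<close> _ slice] insert.prems w
    by (simp add: compact_linear_functional_image convex_linear_functional_image)
  then show ?case by simp
qed

text \<open>Counting nonempty slices gives a relation between the images of the \<open>K i\<close>
  under \<open>w\<close>; the identity for interval tops then isolates the images with maximum
  \<open>t\<close>. The functional \<open>w\<close> may lie outside \<open>\<Phi>\<close>.\<close>

lemma sum_compact_convex_maximum_eq_0:
  fixes K :: "'i \<Rightarrow> 'v::real_normed_vector set" and a :: "'i \<Rightarrow> int"
  assumes \<Phi>: "finite \<Phi>" "\<And>v. v \<in> \<Phi> \<Longrightarrow> bounded_linear (v :: 'v \<Rightarrow> real)"
    and fin: "finite I" and w: "bounded_linear (w :: 'v \<Rightarrow> real)"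
    and cc: "\<And>i. i \<in> I \<Longrightarrow> compact (K i) \<and> convex (K i)"
    and sep: "\<And>x y. x \<in> (\<Union>i\<in>I. K i) \<Longrightarrow> y \<in> (\<Union>i\<in>I. K i) \<Longrightarrow> \<forall>v\<in>\<Phi>. v x = v y \<Longrightarrow> x = y"
    and zero: "\<And>x. (\<Sum>i\<in>I. a i * of_bool (x \<in> K i)) = 0"
  shows "(\<Sum>i\<in>I. a i * of_bool (t \<in> w ` K i \<and> (\<forall>y\<in>K i. w y \<le> t))) = 0"
proof -
  have slice: "(\<Sum>i\<in>I. a i * of_bool (t \<in> w ` K i)) = 0" for t
  proof -
    have "(\<Sum>i\<in>I. a i * of_bool (K i \<inter> {x. w x = t} \<noteq> {})) = 0"
    proof (rule sum_nonempty_compact_convex_eq_0[OF \<Phi>(1) fin \<Phi>(2)])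
      show "(\<Sum>i\<in>I. a i * of_bool (x \<in> K i \<inter> {x. w x = t})) = 0" for x
        using zero[of x] by (cases "w x = t") auto
      show "x = y" if "x \<in> (\<Union>i\<in>I. K i \<inter> {x. w x = t})" "y \<in> (\<Union>i\<in>I. K i \<inter> {x. w x = t})"
        "\<forall>w\<in>\<Phi>. w x = w y" for x y
        using that by (intro sep) auto
    qed (use cc w in \<open>auto intro: compact_slice convex_slice\<close>)
    moreover have "K i \<inter> {x. w x = t} \<noteq> {} \<longleftrightarrow> t \<in> w ` K i" for i by auto
    ultimately show ?thesis by simp
  qed
  have "(\<Sum>i\<in>I. a i * of_bool (t \<in> w ` K i \<and> (\<forall>s\<in>w ` K i. s \<le> t))) = 0"
    using sum_interval_tops_eq_0[where J = "\<lambda>i. w ` K i", OF fin _ slice] cc w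
    by (simp add: compact_linear_functional_image convex_linear_functional_image)
  then show ?thesis by simp
qed

section \<open>Bases and rank\<close>

lemma matroid_axioms:
  shows finite_ground: "finite (ground M)"
    and bases_nonempty: "bases M \<noteq> {}"
    and basis_subset_ground: "B \<in> bases M \<Longrightarrow> B \<subseteq> ground M"
    and basis_exchange: "A \<in> bases M \<Longrightarrow> B \<in> bases M \<Longrightarrow> x \<in> A - B \<Longrightarrow>
      \<exists>y\<in>B - A. insert y (A - {x}) \<in> bases M"
proof -
  obtain E \<B> where E: "Rep_matroid M = (E, \<B>)" by fastforce
  note R = Rep_matroid[of M, unfolded E mem_Collect_eq case_prod_conv]
  show "finite (ground M)" "bases M \<noteq> {}" using R by (simp_all add: ground_def bases_def E)
  show "B \<in> bases M \<Longrightarrow> B \<subseteq> ground M" using R by (simp add: ground_def bases_def E)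
  show "A \<in> bases M \<Longrightarrow> B \<in> bases M \<Longrightarrow> x \<in> A - B \<Longrightarrow>
      \<exists>y\<in>B - A. insert y (A - {x}) \<in> bases M" using R unfolding bases_def E snd_conv by blast
qed

lemma finite_basis: "B \<in> bases M \<Longrightarrow> finite B"
  by (rule finite_subset[OF basis_subset_ground finite_ground])

text \<open>Exchanging an element of \<open>A - B\<close> for one of \<open>B - A\<close> keeps the
  size of \<open>A\<close> and brings it closer to \<open>B\<close>. Once \<open>A\<close> lies
  inside \<open>B\<close>, an element of \<open>B - A\<close> would have no exchange partner, so the
  two are equal.\<close>

lemma card_bases_eq:
  assumes "A \<in> bases M" "B \<in> bases M"
  shows "card A = card B"
  using assms(1)
proof (induction "card (A - B)" arbitrary: A rule: less_induct)
  case less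
  show ?case
  proof (cases "A - B = {}")
    case True
    have "B - A = {}" using basis_exchange[OF assms(2) less.prems] True by blast
    with True have "A = B" by blast
    then show ?thesis by simp
  next
    case False
    then obtain x where x: "x \<in> A - B" by blast
    then obtain y where y: "y \<in> B - A" "insert y (A - {x}) \<in> bases M"
      using basis_exchange[OF less.prems assms(2)] by blast
    have fin: "finite A" by (rule finite_basis[OF less.prems])
    have "insert y (A - {x}) - B = A - B - {x}" using y by blast
    then have "insert y (A - {x}) - B \<subset> A - B" using x by blast
    then have "card (insert y (A - {x}) - B) < card (A - B)"
      by (rule psubset_card_mono[OF finite_Diff[OF fin]])
    then have "card (insert y (A - {x})) = card B"
      by (rule less.hyps[OF _ y(2)])
    moreover have "card (insert y (A - {x})) = Suc (card (A - {x}))"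
      using y fin by (intro card_insert_disjoint finite_Diff) blast+
    moreover have "Suc (card (A - {x})) = card A"
      using x fin by (intro card_Suc_Diff1) auto
    ultimately show ?thesis by presburger
  qed
qed

section \<open>Independent sets, augmentation and the rank function\<close>

lemma indep_subset: "indep M J \<Longrightarrow> I \<subseteq> J \<Longrightarrow> indep M I"
  by (auto simp: indep_def)

lemma indep_subset_ground: "indep M I \<Longrightarrow> I \<subseteq> ground M"
  using basis_subset_ground by (auto simp: indep_def)

lemma finite_indep: "indep M I \<Longrightarrow> finite I"
  by (rule finite_subset[OF indep_subset_ground finite_ground])

lemma indep_empty: "indep M {}"
  using bases_nonempty by (auto simp: indep_def)

text \<open>Let \<open>A\<close> be a basis with
  \<open>I \<subseteq> A \<subseteq> I \<union> B\<close>, where \<open>B\<close> is a basis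
  containing \<open>J\<close>. If \<open>A\<close> missed \<open>J - I\<close>, then
  \<open>A - I\<close> would lie in \<open>B - J\<close>, which is too small because bases have
  equal size and \<open>card I < card J\<close>.\<close>

lemma indep_augment:
  assumes I: "indep M I" and J: "indep M J" and less: "card I < card J"
  obtains x where "x \<in> J - I" "indep M (insert x I)"
proof -
  obtain B where B: "B \<in> bases M" "J \<subseteq> B" using J by (auto simp: indep_def)
  \<comment> \<open>A basis \<open>A \<supseteq> I\<close> closest to \<open>B\<close> satisfies \<open>A \<subseteq> I \<union> B\<close>, by exchange.\<close>
  obtain A0 where "A0 \<in> bases M \<and> I \<subseteq> A0" using I by (auto simp: indep_def)
  moreover have "\<forall>A. A \<in> bases M \<and> I \<subseteq> A \<longrightarrow> card (A \<inter> B) < Suc (card B)"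
    using finite_basis[OF B(1)] by (simp add: card_mono le_imp_less_Suc)
  ultimately have "\<exists>A. (A \<in> bases M \<and> I \<subseteq> A) \<and>
      (\<forall>A'. A' \<in> bases M \<and> I \<subseteq> A' \<longrightarrow> card (A' \<inter> B) \<le> card (A \<inter> B))"
    by (rule ex_has_greatest_nat[of "\<lambda>A. A \<in> bases M \<and> I \<subseteq> A" A0 "\<lambda>A. card (A \<inter> B)" "Suc (card B)"])
  then obtain A where A: "A \<in> bases M" "I \<subseteq> A"
    and max: "\<And>A'. A' \<in> bases M \<Longrightarrow> I \<subseteq> A' \<Longrightarrow> card (A' \<inter> B) \<le> card (A \<inter> B)"
    by auto
  have fin: "finite A" "finite B" using A B finite_basis by auto
  have AB: "A - I \<subseteq> B"
  proof
    fix x assume x: "x \<in> A - I"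
    show "x \<in> B"
    proof (rule ccontr)
      assume "x \<notin> B"
      with x obtain y where y: "y \<in> B - A" "insert y (A - {x}) \<in> bases M"
        using basis_exchange[OF A(1) B(1), of x] by auto
      \<comment> \<open>Removing \<open>x\<close> costs nothing in \<open>B\<close> and nothing in
        \<open>I\<close>, so the exchanged basis would contradict the maximality of
        \<open>A\<close>.\<close>
      have "insert y (A - {x}) \<inter> B = insert y (A \<inter> B)" using \<open>x \<notin> B\<close> y by blast
      then have "card (insert y (A - {x}) \<inter> B) = Suc (card (A \<inter> B))"
        using y fin by simp
      moreover have "I \<subseteq> insert y (A - {x})" using x A by blast
      ultimately show False using max[OF y(2)] by simp
    qed
  qed
  have "\<exists>x\<in>J - I. x \<in> A"
  proof (rule ccontr)
    assume "\<not> ?thesis"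
    with AB have "A - I \<subseteq> B - J" by blast
    then have "card (A - I) \<le> card (B - J)" using fin by (intro card_mono) auto
    then have "card A - card I \<le> card B - card J"
      using A(2) B(2) finite_indep[OF I] finite_indep[OF J] by (simp add: card_Diff_subset)
    moreover have "card A = card B" by (rule card_bases_eq[OF A(1) B(1)])
    moreover have "card J \<le> card B" using B(2) fin by (intro card_mono)
    ultimately show False using less by simp
  qed
  then obtain x where x: "x \<in> J - I" "x \<in> A" by blast
  then have "insert x I \<subseteq> A" using A by simp
  then have "indep M (insert x I)" using A(1) unfolding indep_def by blast
  with x show thesis by (intro that)
qed

lemma finite_indep_subsets: "finite {I. I \<subseteq> S \<and> indep M I}"
proof (rule finite_subset)
  show "{I. I \<subseteq> S \<and> indep M I} \<subseteq> Pow (ground M)" using indep_subset_ground by blast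
  show "finite (Pow (ground M))" using finite_ground by simp
qed

lemma card_le_rk: "indep M I \<Longrightarrow> I \<subseteq> S \<Longrightarrow> card I \<le> rk M S"
  unfolding rk_def by (intro Max_ge finite_imageI finite_indep_subsets) simp

lemma rk_attained:
  obtains I where "I \<subseteq> S" "indep M I" "card I = rk M S"
proof -
  have "rk M S \<in> card ` {I. I \<subseteq> S \<and> indep M I}"
    unfolding rk_def
  proof (intro Max_in finite_imageI finite_indep_subsets)
    have "{} \<in> {I. I \<subseteq> S \<and> indep M I}" using indep_empty by simp
    then show "card ` {I. I \<subseteq> S \<and> indep M I} \<noteq> {}" by blast
  qed
  then show thesis using that by auto
qed

lemma rk_mono: "S \<subseteq> T \<Longrightarrow> rk M S \<le> rk M T"
  by (metis card_le_rk order_trans rk_attained)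

text \<open>As long as \<open>I\<close> is smaller than the rank of \<open>S\<close>, an independent
  subset of \<open>S\<close> of maximum size supplies an element for augmentation.\<close>

lemma indep_extend:
  assumes "indep M I" "I \<subseteq> S"
  obtains J where "I \<subseteq> J" "J \<subseteq> S" "indep M J" "card J = rk M S"
proof -
  have "\<exists>J. I \<subseteq> J \<and> J \<subseteq> S \<and> indep M J \<and> card J = rk M S"
    using assms
  proof (induction "rk M S - card I" arbitrary: I rule: less_induct)
    case less
    show ?case
    proof (cases "card I = rk M S")
      case True
      then show ?thesis using less.prems by blast
    next
      case False
      then have lt: "card I < rk M S" using card_le_rk[OF less.prems] by simp
      obtain K where K: "K \<subseteq> S" "indep M K" "card K = rk M S" by (rule rk_attained)
      obtain x where x: "x \<in> K - I" "indep M (insert x I)"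
        using indep_augment[OF less.prems(1) K(2)] lt K(3) by metis
      have "card (insert x I) = Suc (card I)"
        using x finite_indep[OF less.prems(1)] by simp
      then have "rk M S - card (insert x I) < rk M S - card I" using lt by simp
      then have "\<exists>J. insert x I \<subseteq> J \<and> J \<subseteq> S \<and> indep M J \<and> card J = rk M S"
        using less.hyps x K less.prems by blast
      then show ?thesis by blast
    qed
  qed
  then show thesis using that by blast
qed

text \<open>This is monotonicity of closure, in contrapositive form. A maximum independent subset
  \<open>I\<close> of \<open>F\<close> is extended within \<open>G\<close> and then within
  \<open>insert e G\<close>; the last extension must use \<open>e\<close>, so
  \<open>insert e I\<close> is independent.\<close>

lemma rk_insert_less_antimono:
  assumes "F \<subseteq> G" "rk M G < rk M (insert e G)"
  shows "rk M F < rk M (insert e F)"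
proof -
  obtain I where I: "I \<subseteq> F" "indep M I" "card I = rk M F" by (rule rk_attained)
  obtain J where J: "I \<subseteq> J" "J \<subseteq> G" "indep M J" "card J = rk M G"
    using indep_extend[OF I(2)] I(1) assms(1) by (metis order_trans)
  obtain K where K: "J \<subseteq> K" "K \<subseteq> insert e G" "indep M K" "card K = rk M (insert e G)"
    using indep_extend[OF J(3)] J(2) by (metis subset_insertI2)
  have "e \<in> K"
    using K assms(2) card_le_rk[OF K(3), of G] by (metis linorder_not_less subset_insert)
  then have "insert e I \<subseteq> K" using J K by blast
  then have "indep M (insert e I)" by (rule indep_subset[OF K(3)])
  moreover have "e \<notin> G" using assms(2) by (auto simp: insert_absorb)
  then have "e \<notin> I" using I assms(1) by blast
  ultimately have "Suc (card I) \<le> rk M (insert e F)"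
    using card_le_rk[of M "insert e I" "insert e F"] I finite_indep[OF I(2)] by auto
  then show ?thesis using I by simp
qed

text \<open>Both sides say that \<open>A\<close> lies in the closure of \<open>F\<close>. If the
  rank of \<open>A\<close> were larger, augmenting a maximum independent subset of \<open>F\<close>
  would produce an element of \<open>A\<close> that raises the rank of \<open>F\<close>.\<close>

lemma rk_superset_eq_iff:
  assumes "F \<subseteq> A"
  shows "rk M A = rk M F \<longleftrightarrow> (\<forall>e\<in>A. \<not> rk M F < rk M (insert e F))"
proof
  assume eq: "rk M A = rk M F"
  show "\<forall>e\<in>A. \<not> rk M F < rk M (insert e F)"
  proof
    fix e assume "e \<in> A"
    then have "rk M (insert e F) \<le> rk M A" using assms by (intro rk_mono) simp
    then show "\<not> rk M F < rk M (insert e F)" by (simp add: eq)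
  qed
next
  assume R: "\<forall>e\<in>A. \<not> rk M F < rk M (insert e F)"
  show "rk M A = rk M F"
  proof (rule ccontr)
    assume "rk M A \<noteq> rk M F"
    then have lt: "rk M F < rk M A" using rk_mono[OF assms, of M] by simp
    obtain I where I: "I \<subseteq> F" "indep M I" "card I = rk M F" by (rule rk_attained)
    obtain J where J: "I \<subseteq> J" "J \<subseteq> A" "indep M J" "card J = rk M A"
      using indep_extend[OF I(2)] I(1) assms by (metis order_trans)
    obtain x where x: "x \<in> J - I" "indep M (insert x I)"
      using indep_augment[OF I(2) J(3)] lt I(3) J(4) by metis
    then have "Suc (card I) \<le> rk M (insert x F)"
      using card_le_rk[of M "insert x I" "insert x F"] I finite_indep[OF I(2)] by auto
    then show False using R x J I by (metis DiffD1 Suc_le_lessD subsetD)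
  qed
qed

lemma card_basis_Int_le_rk: "B \<in> bases M \<Longrightarrow> card (B \<inter> C) \<le> rk M C"
  by (intro card_le_rk) (auto simp: indep_def)

text \<open>The greedy argument: work upwards through the chain, extending an independent set to one
  of full rank in the next member, and complete the result to a basis at the end.\<close>

lemma chain_common_basis:
  assumes "finite \<C>" "\<forall>C\<in>\<C>. \<forall>D\<in>\<C>. C \<subseteq> D \<or> D \<subseteq> C"
  shows "\<exists>B\<in>bases M. \<forall>C\<in>\<C>. card (B \<inter> C) = rk M C"
proof -
  \<comment> \<open>A rank once attained survives enlargement, since the size of
    \<open>J \<inter> C\<close> is squeezed between that of \<open>I \<inter> C\<close> and the rank
    of \<open>C\<close>.\<close>
  have keep: "card (J \<inter> C) = rk M C" if "indep M J" "I \<subseteq> J" "card (I \<inter> C) = rk M C" for I J C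
  proof (rule antisym)
    show "card (J \<inter> C) \<le> rk M C" using that(1) by (intro card_le_rk indep_subset[of M J "J \<inter> C"]) auto
    show "rk M C \<le> card (J \<inter> C)"
      unfolding that(3)[symmetric] using that(2) finite_indep[OF that(1)] by (intro card_mono) auto
  qed
  \<comment> \<open>Confining \<open>I\<close> to the union of the chain places it inside the
    largest member \<open>T\<close>, where it can be extended.\<close>
  have "\<exists>I. indep M I \<and> I \<subseteq> \<Union>\<C> \<and> (\<forall>C\<in>\<C>. card (I \<inter> C) = rk M C)"
    using assms
  proof (induction "card \<C>" arbitrary: \<C>)
    case 0
    then show ?case using indep_empty by auto
  next
    case (Suc n)
    then have "\<C> \<noteq> {}" by auto
    then obtain T where T: "T \<in> \<C>" "\<And>C. C \<in> \<C> \<Longrightarrow> C \<subseteq> T"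
      using finite_has_maximal[OF Suc.prems(1)] Suc.prems(2) by metis
    have "n = card (\<C> - {T})" using Suc.hyps(2) T Suc.prems(1) by simp
    then obtain I where I: "indep M I" "I \<subseteq> \<Union>(\<C> - {T})"
        "\<forall>C\<in>\<C> - {T}. card (I \<inter> C) = rk M C"
      using Suc.hyps(1)[of "\<C> - {T}"] Suc.prems by auto
    then have "I \<subseteq> T" using T by blast
    then obtain J where J: "I \<subseteq> J" "J \<subseteq> T" "indep M J" "card J = rk M T"
      using indep_extend[OF I(1)] by metis
    have "\<forall>C\<in>\<C>. card (J \<inter> C) = rk M C"
      using I J keep[OF J(3,1)] by (metis Diff_iff inf.absorb1 singletonD)
    then show ?case using J T by blast
  qed
  then obtain I where I: "indep M I" "\<forall>C\<in>\<C>. card (I \<inter> C) = rk M C" by blast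
  then obtain B where B: "B \<in> bases M" "I \<subseteq> B" by (auto simp: indep_def)
  then have "indep M B" by (auto simp: indep_def)
  then have "\<forall>C\<in>\<C>. card (B \<inter> C) = rk M C" using I(2) B(2) keep[of B I] by blast
  with B(1) show ?thesis by blast
qed

section \<open>Ranks along a chain\<close>

text \<open>Positional notation in base \<open>Suc N\<close>: values up to \<open>N\<close> act as
  digits. The new element receives the unit digit, and the earlier weights are multiplied by the
  base.\<close>

lemma separating_weights:
  assumes "finite A"
  shows "\<exists>\<epsilon> :: 'a \<Rightarrow> nat. \<forall>f g. (\<forall>x\<in>A. f x \<le> N) \<longrightarrow> (\<forall>x\<in>A. g x \<le> N) \<longrightarrow>
      (\<Sum>x\<in>A. \<epsilon> x * f x) = (\<Sum>x\<in>A. \<epsilon> x * g x) \<longrightarrow> (\<forall>x\<in>A. f x = g x)"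
  using assms
proof (induction A rule: finite_induct)
  case empty
  show ?case by simp
next
  case (insert a A)
  then obtain \<epsilon> :: "'a \<Rightarrow> nat" where \<epsilon>:
    "\<And>f g. \<forall>x\<in>A. f x \<le> N \<Longrightarrow> \<forall>x\<in>A. g x \<le> N \<Longrightarrow>
      (\<Sum>x\<in>A. \<epsilon> x * f x) = (\<Sum>x\<in>A. \<epsilon> x * g x) \<Longrightarrow> \<forall>x\<in>A. f x = g x"
    by blast
  define \<delta> where "\<delta> x = (if x = a then 1 else Suc N * \<epsilon> x)" for x
  have \<delta>: "(\<Sum>x\<in>insert a A. \<delta> x * f x) = f a + Suc N * (\<Sum>x\<in>A. \<epsilon> x * f x)" for f
  proof -
    have "(\<Sum>x\<in>A. \<delta> x * f x) = (\<Sum>x\<in>A. Suc N * (\<epsilon> x * f x))"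
      using insert.hyps(2) by (intro sum.cong refl) (auto simp: \<delta>_def simp del: mult_Suc)
    then show ?thesis
      using insert.hyps by (simp add: \<delta>_def sum_distrib_left del: mult_Suc)
  qed
  have "\<forall>x\<in>insert a A. f x = g x"
    if f: "\<forall>x\<in>insert a A. f x \<le> N" and g: "\<forall>x\<in>insert a A. g x \<le> N"
      and eq: "(\<Sum>x\<in>insert a A. \<delta> x * f x) = (\<Sum>x\<in>insert a A. \<delta> x * g x)" for f g
  proof -
    have eq': "f a + Suc N * (\<Sum>x\<in>A. \<epsilon> x * f x) = g a + Suc N * (\<Sum>x\<in>A. \<epsilon> x * g x)"
      using eq unfolding \<delta> .
    have "f a < Suc N" "g a < Suc N" using f g by (simp_all add: less_Suc_eq_le)
    \<comment> \<open>Reduction modulo the base reads off the unit digit.\<close>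
    then have "f a = g a"
      using arg_cong[OF eq', of "\<lambda>n. n mod Suc N"] by (simp del: mult_Suc)
    then have sum_eq: "(\<Sum>x\<in>A. \<epsilon> x * f x) = (\<Sum>x\<in>A. \<epsilon> x * g x)"
      using eq' by (simp del: mult_Suc)
    have "\<forall>x\<in>A. f x = g x" by (rule \<epsilon>[OF _ _ sum_eq]) (use f g in blast)+
    with \<open>f a = g a\<close> show ?thesis by blast
  qed
  then show ?case by blast
qed

section \<open>Base polytopes in coordinate space\<close>

lemma bounded_linear_lookup: "bounded_linear (\<lambda>x :: 'a \<Rightarrow>\<^sub>0 real. Poly_Mapping.lookup x k)"
proof (rule bounded_linear_intro[where K = 1])
  fix x y :: "'a \<Rightarrow>\<^sub>0 real" and r :: real
  show "Poly_Mapping.lookup (x + y) k = Poly_Mapping.lookup x k + Poly_Mapping.lookup y k"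
    by (rule lookup_add)
  show "Poly_Mapping.lookup (r *\<^sub>R x) k = r *\<^sub>R Poly_Mapping.lookup x k"
    by (simp add: scaleR_poly_mapping_def)
  show "norm (Poly_Mapping.lookup x k) \<le> norm x * 1"
  proof (cases "k \<in> Poly_Mapping.keys x")
    case True
    then show ?thesis
      by (simp add: norm_poly_mapping_def dist_poly_mapping_def)
        (rule member_le_sum[of k _ "\<lambda>n. \<bar>Poly_Mapping.lookup x n\<bar>"]; simp)
  next
    case False
    then show ?thesis by (simp add: in_keys_iff)
  qed
qed

lemma lookup_indicator_vector:
  "finite B \<Longrightarrow> Poly_Mapping.lookup (\<Sum>i\<in>B. Poly_Mapping.single i (1 :: real)) k = of_bool (k \<in> B)"
  by (simp add: lookup_sum lookup_single when_def)

lemma finite_bases: "finite (bases M)"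
  by (rule finite_subset[of _ "Pow (ground M)"]) (use basis_subset_ground finite_ground in blast)+

lemma compact_base_polytope: "compact (base_polytope M)"
  unfolding base_polytope_def by (intro finite_imp_compact_convex_hull finite_imageI finite_bases)

lemma convex_base_polytope: "convex (base_polytope M)"
  unfolding base_polytope_def by (rule convex_convex_hull)

lemma indicator_vector_in_base_polytope:
  "B \<in> bases M \<Longrightarrow> (\<Sum>i\<in>B. Poly_Mapping.single i 1) \<in> base_polytope M"
  unfolding base_polytope_def by (rule hull_inc) (rule imageI)

lemma base_polytope_subset:
  assumes "\<And>B. B \<in> bases M \<Longrightarrow> (\<Sum>i\<in>B. Poly_Mapping.single i 1) \<in> S" "convex S"
  shows "base_polytope M \<subseteq> S"
  unfolding base_polytope_def by (rule hull_minimal) (use assms in auto)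

lemma convex_coord_space: "convex (coord_space E)"
proof -
  have "coord_space E = (\<Inter>k\<in>-E. (\<lambda>x. Poly_Mapping.lookup x k) -` {0})"
    by (auto simp: coord_space_def in_keys_iff)
  also have "convex \<dots>"
    by (intro convex_INT convex_linear_vimage bounded_linear.linear bounded_linear_lookup
        convex_singleton)
  finally show ?thesis .
qed

lemma base_polytope_subset_coord_space: "base_polytope M \<subseteq> coord_space (ground M)"
proof (rule base_polytope_subset[OF _ convex_coord_space])
  fix B assume B: "B \<in> bases M"
  show "(\<Sum>i\<in>B. Poly_Mapping.single i 1) \<in> coord_space (ground M)"
    using basis_subset_ground[OF B]
    by (auto simp: coord_space_def in_keys_iff lookup_indicator_vector[OF finite_basis[OF B]])
qed

text \<open>The functional \<open>w\<close> and the value \<open>t\<close> depend on the chain, on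
  \<open>c\<close> and on \<open>E\<close>, but not on \<open>M\<close>, so one slice tests the
  ranks of all matroids on \<open>E\<close> simultaneously.\<close>

lemma chain_ranks_iff_maximum:
  assumes fin: "finite \<C>" and chain: "\<forall>C\<in>\<C>. \<forall>D\<in>\<C>. C \<subseteq> D \<or> D \<subseteq> C"
    and sub: "\<forall>C\<in>\<C>. C \<subseteq> E" and finE: "finite E"
  shows "\<exists>(w :: (nat \<Rightarrow>\<^sub>0 real) \<Rightarrow> real) t. bounded_linear w \<and>
    (\<forall>M. ground M = E \<longrightarrow>
      (t \<in> w ` base_polytope M \<and> (\<forall>y\<in>base_polytope M. w y \<le> t) \<longleftrightarrow> (\<forall>C\<in>\<C>. rk M C = c C)))"
proof -
  \<comment> \<open>A common bound for the ranks, which are at most \<open>card E\<close>, and for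
    the prescribed values \<open>c C\<close>; both must be digits for the separating
    weights.\<close>
  define N where "N = card E + (\<Sum>C\<in>\<C>. c C)"
  have cN: "c C \<le> N" if "C \<in> \<C>" for C
    using member_le_sum[of C \<C> c] that fin by (simp add: N_def)
  obtain \<epsilon> :: "nat set \<Rightarrow> nat" where \<epsilon>:
    "\<forall>f g. (\<forall>C\<in>\<C>. f C \<le> N) \<longrightarrow> (\<forall>C\<in>\<C>. g C \<le> N) \<longrightarrow>
      (\<Sum>C\<in>\<C>. \<epsilon> C * f C) = (\<Sum>C\<in>\<C>. \<epsilon> C * g C) \<longrightarrow> (\<forall>C\<in>\<C>. f C = g C)"
    by (rule exE[OF separating_weights[OF fin]])
  define w :: "(nat \<Rightarrow>\<^sub>0 real) \<Rightarrow> real"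
    where "w x = (\<Sum>C\<in>\<C>. real (\<epsilon> C) * (\<Sum>k\<in>C. Poly_Mapping.lookup x k))" for x
  define t where "t = real (\<Sum>C\<in>\<C>. \<epsilon> C * c C)"
  have w: "bounded_linear w"
    unfolding w_def
    by (intro bounded_linear_sum bounded_linear_const_mult bounded_linear_lookup)
  have "t \<in> w ` base_polytope M \<and> (\<forall>y\<in>base_polytope M. w y \<le> t) \<longleftrightarrow> (\<forall>C\<in>\<C>. rk M C = c C)"
    (is "?L \<longleftrightarrow> ?R") if M: "ground M = E" for M
  proof -
    define m where "m = real (\<Sum>C\<in>\<C>. \<epsilon> C * rk M C)"
    have vertex: "w (\<Sum>i\<in>B. Poly_Mapping.single i 1) = real (\<Sum>C\<in>\<C>. \<epsilon> C * card (B \<inter> C))"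
      if B: "B \<in> bases M" for B
    proof -
      have "(\<Sum>k\<in>C. Poly_Mapping.lookup (\<Sum>i\<in>B. Poly_Mapping.single i (1 :: real)) k)
          = real (card (B \<inter> C))" if "C \<in> \<C>" for C
        using finite_subset[OF bspec[OF sub that] finE]
        by (simp add: lookup_indicator_vector[OF finite_basis[OF B]] Int_commute)
      then show ?thesis by (simp add: w_def)
    qed
    obtain B where B: "B \<in> bases M" and card_B: "\<forall>C\<in>\<C>. card (B \<inter> C) = rk M C"
      using chain_common_basis[where M = M, OF fin chain] by blast
    have "w (\<Sum>i\<in>B. Poly_Mapping.single i 1) = m"
      unfolding vertex[OF B] m_def by (simp add: card_B)
    then have attained: "m \<in> w ` base_polytope M"
      using indicator_vector_in_base_polytope[OF B] by blast
    \<comment> \<open>The half-space is convex, so it suffices to test the vertices, where the bound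
      is termwise.\<close>
    have "base_polytope M \<subseteq> w -` {..m}"
    proof (rule base_polytope_subset)
      show "convex (w -` {..m})"
        by (intro convex_linear_vimage bounded_linear.linear w convex_real_interval)
      fix B assume B: "B \<in> bases M"
      show "(\<Sum>i\<in>B. Poly_Mapping.single i 1) \<in> w -` {..m}"
        unfolding vimage_eq atMost_iff vertex[OF B] m_def of_nat_le_iff
        by (intro sum_mono mult_left_mono card_basis_Int_le_rk B) simp
    qed
    then have upper: "w y \<le> m" if "y \<in> base_polytope M" for y using that by blast
    have "?L \<longleftrightarrow> t = m"
      using attained upper by (auto intro: antisym)
    also have "\<dots> \<longleftrightarrow> (\<Sum>C\<in>\<C>. \<epsilon> C * c C) = (\<Sum>C\<in>\<C>. \<epsilon> C * rk M C)"
      unfolding t_def m_def by (rule of_nat_eq_iff)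
    also have "\<dots> \<longleftrightarrow> ?R"
    proof
      assume eq: "(\<Sum>C\<in>\<C>. \<epsilon> C * c C) = (\<Sum>C\<in>\<C>. \<epsilon> C * rk M C)"
      have rkN: "rk M C \<le> N" if "C \<in> \<C>" for C
      proof -
        have "card (B \<inter> C) \<le> card E"
          using sub that by (intro card_mono finE) blast
        then show ?thesis using card_B that by (simp add: N_def)
      qed
      show ?R
        using \<epsilon>[rule_format, of "rk M" c] rkN cN eq[symmetric] by blast
    qed simp
    finally show ?thesis .
  qed
  with w show ?thesis by (intro exI[of _ w] exI[of _ t]) simp
qed

section \<open>Linear relations between indicator functions of base polytopes\<close>

locale base_polytope_relation =
  fixes I :: "'i set" and M :: "'i \<Rightarrow> matroid" and a :: "'i \<Rightarrow> int" and E :: "nat set"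
  assumes finite_index: "finite I"
    and ground_eq: "\<And>i. i \<in> I \<Longrightarrow> ground (M i) = E"
    and relation: "\<And>x. x \<in> coord_space E \<Longrightarrow> (\<Sum>i\<in>I. a i * indicator (base_polytope (M i)) x) = 0"
    and finite_E: "finite E"
begin

text \<open>The rank conditions say that \<open>w\<close> has maximum \<open>t\<close> on the
  polytope, so the result on maxima applies, with the coordinates indexed by \<open>E\<close> as
  separating functionals.\<close>

lemma sum_chain_ranks_eq_0:
  assumes fin: "finite \<C>" and chain: "\<forall>C\<in>\<C>. \<forall>D\<in>\<C>. C \<subseteq> D \<or> D \<subseteq> C"
    and sub: "\<forall>C\<in>\<C>. C \<subseteq> E"
  shows "(\<Sum>i\<in>I. a i * of_bool (\<forall>C\<in>\<C>. rk (M i) C = c C)) = 0"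
proof -
  obtain w :: "(nat \<Rightarrow>\<^sub>0 real) \<Rightarrow> real" and t where w: "bounded_linear w"
    and max: "\<And>M. ground M = E \<Longrightarrow>
      t \<in> w ` base_polytope M \<and> (\<forall>y\<in>base_polytope M. w y \<le> t) \<longleftrightarrow> (\<forall>C\<in>\<C>. rk M C = c C)"
    using chain_ranks_iff_maximum[where c = c, OF fin chain sub finite_E] by blast
  have in_coord: "x \<in> coord_space E" if "i \<in> I" "x \<in> base_polytope (M i)" for i x
    using base_polytope_subset_coord_space[of "M i"] that ground_eq by auto
  have "(\<Sum>i\<in>I. a i * of_bool (t \<in> w ` base_polytope (M i) \<and> (\<forall>y\<in>base_polytope (M i). w y \<le> t))) = 0"
  proof (rule sum_compact_convex_maximum_eq_0[where \<Phi> = "(\<lambda>k x. Poly_Mapping.lookup x k) ` E"])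
    show "(\<Sum>i\<in>I. a i * of_bool (x \<in> base_polytope (M i))) = 0" for x
    \<comment> \<open>The relation is given on \<open>coord_space E\<close> only; outside it every
      indicator vanishes.\<close>
    proof (cases "x \<in> coord_space E")
      case True
      then show ?thesis using relation[OF True] by (simp add: indicator_def of_bool_def)
    next
      case False
      then show ?thesis using in_coord by (intro sum.neutral) auto
    qed
    show "x = y" if "x \<in> (\<Union>i\<in>I. base_polytope (M i))" "y \<in> (\<Union>i\<in>I. base_polytope (M i))"
      "\<forall>v\<in>(\<lambda>k x. Poly_Mapping.lookup x k) ` E. v x = v y" for x y
    proof (rule poly_mapping_eqI)
      have "x \<in> coord_space E" "y \<in> coord_space E" using that(1,2) in_coord by auto
      then have "Poly_Mapping.lookup x k = 0 \<and> Poly_Mapping.lookup y k = 0" if "k \<notin> E" for k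
        using that by (auto simp: coord_space_def in_keys_iff subset_iff)
      then show "Poly_Mapping.lookup x k = Poly_Mapping.lookup y k" for k
        using that(3) by (cases "k \<in> E") simp_all
    qed
  qed (use finite_E finite_index w bounded_linear_lookup compact_base_polytope
      convex_base_polytope in auto)
  then show ?thesis by (simp add: max ground_eq cong: sum.cong)
qed

text \<open>Conditions are given as pairs because one set may be assigned several values. Either
  some \<open>M j\<close> meets them all, and its rank function serves as the prescription, or every
  summand is zero.\<close>

lemma sum_chain_rank_pairs_eq_0:
  assumes fin: "finite S" and chain: "\<forall>C\<in>fst ` S. \<forall>D\<in>fst ` S. C \<subseteq> D \<or> D \<subseteq> C"
    and sub: "\<forall>C\<in>fst ` S. C \<subseteq> E"
  shows "(\<Sum>i\<in>I. a i * of_bool (\<forall>(C, c)\<in>S. rk (M i) C = c)) = 0"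
proof (cases "\<exists>j\<in>I. \<forall>(C, c)\<in>S. rk (M j) C = c")
  case True
  then obtain j where j: "\<forall>(C, c)\<in>S. rk (M j) C = c" by blast
  then have "(\<forall>(C, c)\<in>S. rk (M i) C = c) \<longleftrightarrow> (\<forall>C\<in>fst ` S. rk (M i) C = rk (M j) C)" for i
    by force
  moreover have "(\<Sum>i\<in>I. a i * of_bool (\<forall>C\<in>fst ` S. rk (M i) C = rk (M j) C)) = 0"
    by (rule sum_chain_ranks_eq_0[OF finite_imageI[OF fin] chain sub])
  ultimately show ?thesis by simp
next
  case False
  then have "\<not> (\<forall>(C, c)\<in>S. rk (M i) C = c)" if "i \<in> I" for i using that by blast
  then show ?thesis by (intro sum.neutral ballI) simp
qed

end

section \<open>Flags of flats\<close>

lemma sum_alternating_Pow: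
  "finite Z \<Longrightarrow> (\<Sum>X\<in>Pow Z. (- 1) ^ card X) = (of_bool (Z = {}) :: int)"
proof -
  assume fin: "finite Z"
  \<comment> \<open>The alternating sum is the expansion of a product of factors
    \<open>1 - 1\<close>, one for each element of \<open>Z\<close>.\<close>
  have "(\<Sum>X\<in>Pow Z. (- 1) ^ card X) = (\<Prod>x\<in>Z. 1 - 1 :: int)"
    unfolding prod_diff_conv_sum[OF fin] by simp
  also have "\<dots> = of_bool (Z = {})" using fin by (simp add: power_0_left)
  finally show ?thesis .
qed

text \<open>Let \<open>Z\<close> be the part of \<open>H - F\<close> in the closure of
  \<open>F\<close>. The sets \<open>A\<close> with the rank of \<open>F\<close> are the unions of
  \<open>F\<close> with subsets of \<open>Z\<close>, so the alternating sum is 1 if \<open>Z\<close>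
  is empty, that is, if \<open>F\<close> is closed in \<open>H\<close>, and 0 otherwise.\<close>

lemma flat_indicator_alternating_sum:
  assumes "finite H" "F \<subseteq> H"
  shows "(of_bool (rk M F = r \<and> (\<forall>e\<in>H - F. rk M F < rk M (insert e F))) :: int)
    = (\<Sum>A\<in>{A. F \<subseteq> A \<and> A \<subseteq> H}. (- 1) ^ card (A - F) * of_bool (rk M F = r \<and> rk M A = r))"
proof (cases "rk M F = r")
  case False
  then show ?thesis by simp
next
  case True
  define Z where "Z = {e \<in> H - F. \<not> rk M F < rk M (insert e F)}"
  have Z: "rk M A = r \<longleftrightarrow> A - F \<subseteq> Z" if "F \<subseteq> A" "A \<subseteq> H" for A
  proof -
    have "rk M A = r \<longleftrightarrow> (\<forall>e\<in>A. \<not> rk M F < rk M (insert e F))"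
      using rk_superset_eq_iff[OF that(1), of M] True by simp
    also have "\<dots> \<longleftrightarrow> (\<forall>e\<in>A - F. \<not> rk M F < rk M (insert e F))"
      by (metis Diff_iff insert_absorb less_irrefl)
    also have "\<dots> \<longleftrightarrow> A - F \<subseteq> Z"
      using that(2) unfolding Z_def by blast
    finally show ?thesis .
  qed
  have "(\<Sum>A\<in>{A. F \<subseteq> A \<and> A \<subseteq> H}. (- 1) ^ card (A - F) * of_bool (rk M F = r \<and> rk M A = r))
      = (\<Sum>A\<in>{A. F \<subseteq> A \<and> A \<subseteq> H}. (- 1) ^ card (A - F) * (of_bool (A - F \<subseteq> Z) :: int))"
    using Z True by (intro sum.cong refl) simp
  also have "\<dots> = (\<Sum>X\<in>Pow (H - F). (- 1) ^ card X * of_bool (X \<subseteq> Z))"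
  proof (rule sum.reindex_bij_witness[where i = "\<lambda>X. F \<union> X" and j = "\<lambda>A. A - F"])
    fix X assume X: "X \<in> Pow (H - F)"
    then show "F \<union> X - F = X" by blast
    show "F \<union> X \<in> {A. F \<subseteq> A \<and> A \<subseteq> H}" using X assms(2) by blast
  qed blast+
  also have "\<dots> = (\<Sum>X\<in>Pow Z. (- 1) ^ card X)"
  proof (rule sum.mono_neutral_cong_right)
    show "finite (Pow (H - F))" using assms(1) by simp
    show "Pow Z \<subseteq> Pow (H - F)" unfolding Z_def by blast
  qed simp_all
  also have "\<dots> = of_bool (Z = {})"
    by (rule sum_alternating_Pow) (use assms(1) in \<open>simp add: Z_def\<close>)
  also have "Z = {} \<longleftrightarrow> (\<forall>e\<in>H - F. rk M F < rk M (insert e F))"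
    unfolding Z_def by blast
  finally show ?thesis using True by simp
qed

text \<open>The term \<open>hd (Fs @ [E])\<close> is the next larger member, or \<open>E\<close>
  after the last one. Closedness is required only relative to it, so the alternating sum for
  \<open>F\<close> involves only sets between \<open>F\<close> and its successor.\<close>

fun flat_chain :: "matroid \<Rightarrow> nat set \<Rightarrow> nat set list \<Rightarrow> nat list \<Rightarrow> bool" where
  "flat_chain M E [] [] \<longleftrightarrow> True"
| "flat_chain M E (F # Fs) (r # rs) \<longleftrightarrow> F \<subseteq> hd (Fs @ [E]) \<and>
     (rk M F = r \<and> (\<forall>e\<in>hd (Fs @ [E]) - F. rk M F < rk M (insert e F))) \<and> flat_chain M E Fs rs"
| "flat_chain M E _ _ \<longleftrightarrow> False"

text \<open>For \<open>e\<close> outside \<open>G\<close>, flatness of \<open>G\<close> makes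
  \<open>e\<close> raise the rank of \<open>G\<close>, and hence that of the smaller set
  \<open>F\<close>.\<close>

lemma flat_relative_flat:
  assumes "F \<subseteq> G" "G \<in> flats M" "\<forall>e\<in>G - F. rk M F < rk M (insert e F)"
  shows "F \<in> flats M"
proof -
  have "rk M F < rk M (insert e F)" if "e \<in> ground M - F" for e
  proof (cases "e \<in> G")
    case True
    then show ?thesis using assms(3) that by blast
  next
    case False
    then have "rk M G < rk M (insert e G)" using assms(2) that by (simp add: flats_def)
    then show ?thesis by (rule rk_insert_less_antimono[OF assms(1)])
  qed
  then show ?thesis using assms(1,2) by (auto simp: flats_def)
qed

lemma ground_flat: "ground M \<in> flats M"
  by (simp add: flats_def)

text \<open>Flatness descends along the flag from the ground set, which is itself a flat: each
  member is a flat as soon as it is closed in its successor.\<close>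

lemma flat_chain_iff:
  "set Fs \<subseteq> flats M \<and> sorted_wrt (\<subseteq>) Fs \<and> map (rk M) Fs = rs \<longleftrightarrow> flat_chain M (ground M) Fs rs"
proof (induction Fs arbitrary: rs)
  case Nil
  then show ?case by (cases rs) simp_all
next
  case (Cons F Fs)
  define H where "H = hd (Fs @ [ground M])"
  show ?case
  proof (cases rs)
    case Nil
    then show ?thesis by simp
  next
    case (Cons r rs')
    note IH = Cons.IH[of rs']
    have "set (F # Fs) \<subseteq> flats M \<and> sorted_wrt (\<subseteq>) (F # Fs) \<longleftrightarrow>
        F \<subseteq> H \<and> (\<forall>e\<in>H - F. rk M F < rk M (insert e F))"
      if Fs: "set Fs \<subseteq> flats M" "sorted_wrt (\<subseteq>) Fs"
    proof -
      have H: "H \<in> flats M"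
        using Fs(1) ground_flat by (cases Fs) (simp_all add: H_def)
      \<comment> \<open>For empty \<open>Fs\<close> the left side is vacuous and \<open>H\<close> is
        the ground set; this is where \<open>F \<subseteq> ground M\<close> enters.\<close>
      have "(\<forall>G\<in>set Fs. F \<subseteq> G) \<longleftrightarrow> F \<subseteq> H" if "F \<subseteq> ground M"
        using Fs(2) that by (cases Fs) (auto simp: H_def)
      then have "set (F # Fs) \<subseteq> flats M \<and> sorted_wrt (\<subseteq>) (F # Fs) \<longleftrightarrow> F \<in> flats M \<and> F \<subseteq> H"
        using Fs by (auto simp: flats_def)
      also have "\<dots> \<longleftrightarrow> F \<subseteq> H \<and> (\<forall>e\<in>H - F. rk M F < rk M (insert e F))"
      proof -
        have "H \<subseteq> ground M" using H by (simp add: flats_def)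
        then have "\<forall>e\<in>H - F. rk M F < rk M (insert e F)" if "F \<in> flats M"
          using that unfolding flats_def by blast
        then show ?thesis using flat_relative_flat[OF _ H] by blast
      qed
      finally show ?thesis .
    qed
    moreover have "set (F # Fs) \<subseteq> flats M \<and> sorted_wrt (\<subseteq>) (F # Fs) \<Longrightarrow>
        set Fs \<subseteq> flats M \<and> sorted_wrt (\<subseteq>) Fs" by simp
    ultimately show ?thesis
      unfolding Cons flat_chain.simps IH[symmetric] H_def[symmetric] list.map list.inject by blast
  qed
qed


section \<open>Vanishing of the weighted flag counts\<close>

context base_polytope_relation
begin

text \<open>\<open>S\<close> collects rank conditions on sets below the unprocessed part of the
  flag. Processing \<open>F\<close> replaces its closedness in \<open>H\<close> by an alternating
  sum over \<open>A\<close>, each term adding the pairs \<open>(F, r)\<close> and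
  \<open>(A, r)\<close> to \<open>S\<close>. At the end only rank conditions along a chain
  remain.\<close>

lemma sum_flat_chain_eq_0:
  assumes "finite S" "\<forall>C\<in>fst ` S. \<forall>D\<in>fst ` S. C \<subseteq> D \<or> D \<subseteq> C"
    and "\<forall>C\<in>fst ` S. C \<subseteq> hd (Fs @ [E])" "set Fs \<subseteq> Pow E"
  shows "(\<Sum>i\<in>I. a i *
    of_bool ((\<forall>(C, c)\<in>S. rk (M i) C = c) \<and> flat_chain (M i) E Fs rs)) = 0"
  using assms
proof (induction Fs arbitrary: S rs)
  case Nil
  then show ?case
    by (cases rs) (simp_all add: sum_chain_rank_pairs_eq_0)
next
  case (Cons F Fs)
  define H where "H = hd (Fs @ [E])"
  show ?case
  proof (cases "\<exists>r rs'. rs = r # rs' \<and> F \<subseteq> H")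
    case False
    then have "\<not> flat_chain (M i) E (F # Fs) rs" for i
      by (cases rs) (simp_all add: H_def)
    then show ?thesis by simp
  next
    case True
    then obtain r rs' where rs: "rs = r # rs'" and F: "F \<subseteq> H" by blast
    have "H \<subseteq> E" using Cons.prems(4) by (cases Fs) (simp_all add: H_def)
    then have finH: "finite H" using finite_E finite_subset by blast
    define \<A> where "\<A> = {A. F \<subseteq> A \<and> A \<subseteq> H}"
    define P where "P A i \<longleftrightarrow> (\<forall>(C, c)\<in>insert (F, r) (insert (A, r) S). rk (M i) C = c) \<and>
      flat_chain (M i) E Fs rs'" for A i
    have IH: "(\<Sum>i\<in>I. a i * of_bool (P A i)) = 0" if A: "A \<in> \<A>" for A
      unfolding P_def
    proof (rule Cons.IH)
      \<comment> \<open>All earlier sets lie below \<open>F\<close>, and \<open>A\<close> lies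
        between \<open>F\<close> and \<open>H\<close>, so the enlarged collection is still a chain
        below the next member.\<close>
      have S: "\<forall>C\<in>fst ` S. C \<subseteq> F" using Cons.prems(3) by simp
      then show "\<forall>C\<in>fst ` insert (F, r) (insert (A, r) S). C \<subseteq> hd (Fs @ [E])"
        using A F unfolding \<A>_def H_def[symmetric] by auto
      show "\<forall>C\<in>fst ` insert (F, r) (insert (A, r) S). \<forall>D\<in>fst ` insert (F, r) (insert (A, r) S).
          C \<subseteq> D \<or> D \<subseteq> C"
        using S A Cons.prems(2) unfolding \<A>_def image_insert fst_conv
        by (intro ballI) (elim insertE; blast)
    qed (use Cons.prems in simp_all)
    have "of_bool ((\<forall>(C, c)\<in>S. rk (M i) C = c) \<and> flat_chain (M i) E (F # Fs) rs)
        = (\<Sum>A\<in>\<A>. (- 1) ^ card (A - F) * (of_bool (P A i) :: int))" for i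
    proof -
      let ?Q = "(\<forall>(C, c)\<in>S. rk (M i) C = c) \<and> flat_chain (M i) E Fs rs'"
      have "of_bool ((\<forall>(C, c)\<in>S. rk (M i) C = c) \<and> flat_chain (M i) E (F # Fs) rs)
          = of_bool ?Q * (of_bool (rk (M i) F = r \<and>
              (\<forall>e\<in>H - F. rk (M i) F < rk (M i) (insert e F))) :: int)"
        unfolding rs flat_chain.simps H_def[symmetric] of_bool_conj[symmetric] using F by auto
      also have "\<dots> = (\<Sum>A\<in>\<A>. (- 1) ^ card (A - F) *
          (of_bool ?Q * of_bool (rk (M i) F = r \<and> rk (M i) A = r)))"
        unfolding flat_indicator_alternating_sum[OF finH F] \<A>_def
        by (simp only: sum_distrib_left mult.left_commute)
      also have "\<dots> = (\<Sum>A\<in>\<A>. (- 1) ^ card (A - F) * of_bool (P A i))"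
        unfolding of_bool_conj[symmetric] P_def
        by (intro sum.cong refl arg_cong2[where f = times] arg_cong[where f = of_bool]) auto
      finally show ?thesis .
    qed
    then have "(\<Sum>i\<in>I. a i *
          of_bool ((\<forall>(C, c)\<in>S. rk (M i) C = c) \<and> flat_chain (M i) E (F # Fs) rs))
        = (\<Sum>i\<in>I. \<Sum>A\<in>\<A>. (- 1) ^ card (A - F) * (a i * of_bool (P A i)))"
      by (simp only: sum_distrib_left mult.left_commute)
    also have "\<dots> = (\<Sum>A\<in>\<A>. (- 1) ^ card (A - F) * (\<Sum>i\<in>I. a i * of_bool (P A i)))"
      unfolding sum_distrib_left by (rule sum.swap)
    also have "\<dots> = 0"
      by (intro sum.neutral ballI) (simp add: IH)
    finally show ?thesis .
  qed
qed

lemma sum_flag_f_vector_eq_0: "(\<Sum>i\<in>I. a i * flag_f_vector (M i) R) = 0"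
proof -
  define rs where "rs = sorted_list_of_fset R"
  \<comment> \<open>A finite set of candidate flags that does not depend on \<open>i\<close>, so
    that the two summations can be exchanged.\<close>
  define L where "L = {Fs. set Fs \<subseteq> Pow E \<and> length Fs = length rs}"
  have finL: "finite L" unfolding L_def using finite_E by (simp add: finite_lists_length_eq)
  have "flag_f_vector (M i) R = (\<Sum>Fs\<in>L. of_bool (flat_chain (M i) E Fs rs))" if "i \<in> I" for i
  proof -
    have "flags (M i) R = {Fs. flat_chain (M i) E Fs rs}"
      unfolding flags_def rs_def flat_chain_iff ground_eq[OF that] ..
    moreover have "flags (M i) R \<subseteq> L"
    proof
      fix Fs assume Fs: "Fs \<in> flags (M i) R"
      then have "map (rk (M i)) Fs = rs" by (simp add: flags_def rs_def)
      then have "length Fs = length rs" by (metis length_map)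
      moreover have "set Fs \<subseteq> Pow E"
        using Fs ground_eq[OF that] by (auto simp: flags_def flats_def)
      ultimately show "Fs \<in> L" by (simp add: L_def)
    qed
    ultimately have "flags (M i) R = L \<inter> {Fs. flat_chain (M i) E Fs rs}" by blast
    then show ?thesis using finL by (simp add: flag_f_vector_def)
  qed
  then have "(\<Sum>i\<in>I. a i * flag_f_vector (M i) R)
      = (\<Sum>i\<in>I. \<Sum>Fs\<in>L. a i * of_bool (flat_chain (M i) E Fs rs))"
    by (simp add: sum_distrib_left)
  also have "\<dots> = (\<Sum>Fs\<in>L. \<Sum>i\<in>I. a i * of_bool (flat_chain (M i) E Fs rs))"
    by (rule sum.swap)
  also have "\<dots> = 0"
  proof (rule sum.neutral, rule ballI)
    fix Fs assume "Fs \<in> L"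
    then have "set Fs \<subseteq> Pow E" by (simp add: L_def)
    then show "(\<Sum>i\<in>I. a i * of_bool (flat_chain (M i) E Fs rs)) = 0"
      using sum_flat_chain_eq_0[of "{}" Fs rs] by simp
  qed
  finally show ?thesis .
qed

end

section \<open>From single flag counts to the function-valued valuation\<close>

lemma sum_fun_apply: "(\<Sum>i\<in>I. f i) x = (\<Sum>i\<in>I. f i x)"
  for f :: "'i \<Rightarrow> 'a \<Rightarrow> 'b::comm_monoid_add"
  by (induction I rule: infinite_finite_induct) simp_all

lemma int_scale_fun_apply: "int_scale n f x = n * f x" for f :: "'a \<Rightarrow> int"
  by (simp add: int_scale_def sum_fun_apply fun_diff_def algebra_simps)

lemma valuation_flag_f_vector: "valuation flag_f_vector"
  unfolding valuation_def
proof (intro allI impI)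
  fix s :: nat and E :: "nat set" and M :: "nat \<Rightarrow> matroid" and a :: "nat \<Rightarrow> int"
  assume ground: "\<forall>i\<in>{1..s}. ground (M i) = E"
    and rel: "\<forall>x\<in>coord_space E. (\<Sum>i=1..s. a i * indicator (base_polytope (M i)) x) = 0"
  show "(\<Sum>i=1..s. int_scale (a i) (flag_f_vector (M i))) = 0"
  \<comment> \<open>For \<open>s = 0\<close> the set \<open>E\<close> is arbitrary and may be
    infinite; otherwise it is the ground set of a matroid.\<close>
  proof (cases "s = 0")
    case True
    then show ?thesis by simp
  next
    case False
    then have "E = ground (M 1)" using ground by simp
    then have "finite E" using finite_ground by simp
    then interpret base_polytope_relation "{1..s}" M a E
      by unfold_locales (use ground rel in auto)
    show ?thesis
    proof
      fix R
      show "(\<Sum>i=1..s. int_scale (a i) (flag_f_vector (M i))) R = 0 R"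
        using sum_flag_f_vector_eq_0[of R] by (simp add: sum_fun_apply int_scale_fun_apply)
    qed
  qed
qed

section \<open>Isomorphism invariance\<close>

context
  fixes \<phi> M N
  assumes iso_bij: "bij_betw \<phi> (ground M) (ground N)"
    and iso_bases: "\<forall>B\<subseteq>ground M. B \<in> bases M \<longleftrightarrow> \<phi> ` B \<in> bases N"
begin

lemma iso_inj_on: "inj_on \<phi> (ground M)" and iso_image_ground: "\<phi> ` ground M = ground N"
  using iso_bij by (simp_all add: bij_betw_def)

lemma iso_bases_iff: "B \<subseteq> ground M \<Longrightarrow> \<phi> ` B \<in> bases N \<longleftrightarrow> B \<in> bases M"
  using iso_bases by simp

lemma iso_subset_ground:
  assumes "G \<subseteq> ground N"
  shows "\<exists>F\<subseteq>ground M. G = \<phi> ` F"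
  using assms unfolding iso_image_ground[symmetric] subset_image_iff .

lemma iso_subset_iff:
  "A \<subseteq> ground M \<Longrightarrow> B \<subseteq> ground M \<Longrightarrow> \<phi> ` A \<subseteq> \<phi> ` B \<longleftrightarrow> A \<subseteq> B"
  by (rule inj_on_image_subset_iff[OF iso_inj_on])

lemma iso_indep_iff:
  assumes "S \<subseteq> ground M"
  shows "indep N (\<phi> ` S) \<longleftrightarrow> indep M S"
proof
  assume "indep M S"
  then obtain B where B: "B \<in> bases M" "S \<subseteq> B" unfolding indep_def by blast
  have "\<phi> ` B \<in> bases N"
    by (rule iffD2[OF iso_bases_iff[OF basis_subset_ground[OF B(1)]] B(1)])
  moreover have "\<phi> ` S \<subseteq> \<phi> ` B" by (rule image_mono[OF B(2)])
  ultimately show "indep N (\<phi> ` S)" unfolding indep_def by blast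
next
  assume "indep N (\<phi> ` S)"
  then obtain C where C: "C \<in> bases N" "\<phi> ` S \<subseteq> C" unfolding indep_def by blast
  obtain B where B: "B \<subseteq> ground M" "C = \<phi> ` B"
    using iso_subset_ground[OF basis_subset_ground[OF C(1)]] by blast
  have "B \<in> bases M" using C(1) B iso_bases_iff by simp
  moreover have "S \<subseteq> B" using C(2) unfolding B(2) iso_subset_iff[OF assms B(1)] .
  ultimately show "indep M S" unfolding indep_def by blast
qed

text \<open>The independent subsets of the image of \<open>S\<close> are the images of those of
  \<open>S\<close>, and injectivity preserves their sizes.\<close>

lemma iso_rk:
  assumes "S \<subseteq> ground M"
  shows "rk N (\<phi> ` S) = rk M S"
proof -
  have "{J. J \<subseteq> \<phi> ` S \<and> indep N J} = image \<phi> ` {J. J \<subseteq> S \<and> indep M J}"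
  proof (intro equalityI subsetI)
    fix J assume J: "J \<in> {J. J \<subseteq> \<phi> ` S \<and> indep N J}"
    then obtain K where K: "K \<subseteq> S" "J = \<phi> ` K" by (auto simp: subset_image_iff)
    then have "indep M K" using J iso_indep_iff[of K] assms by simp
    then show "J \<in> image \<phi> ` {J. J \<subseteq> S \<and> indep M J}" using K by blast
  next
    fix J assume "J \<in> image \<phi> ` {J. J \<subseteq> S \<and> indep M J}"
    then obtain K where K: "K \<subseteq> S" "J = \<phi> ` K" "indep M K" by blast
    then have "indep N J" using iso_indep_iff[of K] assms by simp
    then show "J \<in> {J. J \<subseteq> \<phi> ` S \<and> indep N J}" using K by blast
  qed
  then have "card ` {J. J \<subseteq> \<phi> ` S \<and> indep N J} = (\<lambda>J. card (\<phi> ` J)) ` {J. J \<subseteq> S \<and> indep M J}"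
    by (simp add: image_image)
  also have "\<dots> = card ` {J. J \<subseteq> S \<and> indep M J}"
  proof (rule image_cong[OF refl])
    fix J assume "J \<in> {J. J \<subseteq> S \<and> indep M J}"
    then have "J \<subseteq> ground M" using assms by blast
    then show "card (\<phi> ` J) = card J" by (intro card_image inj_on_subset[OF iso_inj_on])
  qed
  finally show ?thesis by (simp add: rk_def)
qed

lemma iso_flats_iff:
  assumes "F \<subseteq> ground M"
  shows "\<phi> ` F \<in> flats N \<longleftrightarrow> F \<in> flats M"
proof -
  have sub: "\<phi> ` F \<subseteq> ground N" using assms iso_image_ground by blast
  have "ground N - \<phi> ` F = \<phi> ` (ground M - F)"
    unfolding iso_image_ground[symmetric]
    by (rule inj_on_image_set_diff[OF iso_inj_on, symmetric]) (use assms in auto)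
  then have "\<phi> ` F \<in> flats N \<longleftrightarrow>
      (\<forall>e\<in>ground M - F. rk N (\<phi> ` F) < rk N (\<phi> ` insert e F))"
    using sub by (simp add: flats_def)
  also have "\<dots> \<longleftrightarrow> (\<forall>e\<in>ground M - F. rk M F < rk M (insert e F))"
    \<comment> \<open>The image of \<open>insert e F\<close> must stay unexpanded for
      \<open>iso_rk\<close> to apply to it.\<close>
    using assms by (intro ball_cong refl) (simp add: iso_rk del: image_insert)
  finally show ?thesis using assms by (simp add: flats_def)
qed

lemma iso_flags_iff:
  assumes "set Fs \<subseteq> Pow (ground M)"
  shows "map (image \<phi>) Fs \<in> flags N R \<longleftrightarrow> Fs \<in> flags M R"
proof -
  have F: "F \<subseteq> ground M" if "F \<in> set Fs" for F using assms that by blast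
  have "set (map (image \<phi>) Fs) \<subseteq> flats N \<longleftrightarrow> (\<forall>F\<in>set Fs. \<phi> ` F \<in> flats N)"
    by (simp add: image_subset_iff)
  also have "\<dots> \<longleftrightarrow> set Fs \<subseteq> flats M"
    using iso_flats_iff[OF F] by blast
  finally have "set (map (image \<phi>) Fs) \<subseteq> flats N \<longleftrightarrow> set Fs \<subseteq> flats M" .
  moreover have "sorted_wrt (\<subseteq>) (map (image \<phi>) Fs) \<longleftrightarrow> sorted_wrt (\<subseteq>) Fs"
  proof -
    have "\<phi> ` (Fs ! i) \<subseteq> \<phi> ` (Fs ! j) \<longleftrightarrow> Fs ! i \<subseteq> Fs ! j"
      if "i < j" "j < length Fs" for i j
      using that by (intro iso_subset_iff F nth_mem) simp_all
    then show ?thesis by (simp add: sorted_wrt_iff_nth_less)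
  qed
  moreover have "map (rk N) (map (image \<phi>) Fs) = map (rk M) Fs"
    using iso_rk[OF F] by simp
  ultimately show ?thesis unfolding flags_def mem_Collect_eq by (simp only:)
qed

text \<open>Applying \<open>\<phi>\<close> to every member of a flag is a bijection between the
  flags: it is injective on lists of subsets of the ground set, and every subset of
  \<open>ground N\<close> is an image.\<close>

lemma iso_flag_f_vector: "flag_f_vector M = flag_f_vector N"
proof
  fix R
  have sub: "flags K R \<subseteq> lists (Pow (ground K))" for K
    by (auto simp: flags_def flats_def)
  have "flags N R = map (image \<phi>) ` flags M R"
  proof (intro equalityI subsetI)
    fix Gs assume Gs: "Gs \<in> flags N R"
    then have "Gs \<in> lists (Pow (ground N))" using sub by blast
    also have "lists (Pow (ground N)) = map (image \<phi>) ` lists (Pow (ground M))"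
      unfolding image_Pow_surj[OF iso_image_ground, symmetric] by (rule lists_image)
    finally obtain Fs where Fs: "Fs \<in> lists (Pow (ground M))" "Gs = map (image \<phi>) Fs"
      by blast
    then have "Fs \<in> flags M R" using iso_flags_iff[of Fs R] Gs by auto
    then show "Gs \<in> map (image \<phi>) ` flags M R" using Fs(2) by blast
  next
    fix Gs assume "Gs \<in> map (image \<phi>) ` flags M R"
    then obtain Fs where Fs: "Fs \<in> flags M R" "Gs = map (image \<phi>) Fs" by blast
    then have "Fs \<in> lists (Pow (ground M))" using sub by blast
    then have "set Fs \<subseteq> Pow (ground M)" by auto
    then show "Gs \<in> flags N R" using iso_flags_iff[of Fs R] Fs by simp
  qed
  moreover have "inj_on (map (image \<phi>)) (flags M R)"
    by (rule inj_on_subset[OF inj_on_map_lists[OF inj_on_image_Pow[OF iso_inj_on]] sub])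
  ultimately show "flag_f_vector M R = flag_f_vector N R"
    by (simp add: flag_f_vector_def card_image)
qed

end

theorem theorem8p2:
  shows "valuative_invariant flag_f_vector"
  unfolding valuative_invariant_def
proof (intro conjI allI impI)
  show "valuation flag_f_vector" by (rule valuation_flag_f_vector)
  fix M N assume "matroid_iso M N"
  then show "flag_f_vector M = flag_f_vector N"
    unfolding matroid_iso_def by (elim exE conjE) (rule iso_flag_f_vector)
qed

end
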